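(* Let $h\geq 2$ be an integer, $\omega:=\exp(2\pi\mathrm{i}/h)$, and let $A\in M_n(\mathbb{C})$ be nonsingular and $h$-cyclic with consecutive ordered partition $\Pi=(\pi_1,\dots,\pi_h)$ of $\{1,\dots,n\}$. Let $$Z^{-1}AZ = J = \bigoplus_{i=1}^{t'} J(\lambda_i\nu_h, r_i)$$ be a Jordan canonical form of $A$, where $J(\lambda\nu_h,r) := J_r(\lambda)\oplus J_r(\lambda\omega)\oplus\cdots\oplus J_r(\lambda\omega^{h-1})\in M_{rh}(\mathbb{C})$, and where the Jordan chains forming the columns of $Z$ are selected compatibly with the $h$-cyclic structure (as described in the context). For $i=1,\dots,t'$, let $$A_{\lambda_i} := Z\,\mathrm{diag}\bigl(0,\dots,0,J(\lambda_i\nu_h,r_i),0,\dots,0\bigr)\,Z^{-1}\in M_n(\mathbb{C}),$$ where $J(\lambda_i\nu_h,r_i)$ occupies the $i$-th diagonal block position (the block partition being that of $J$). Then for each $i=1,\dots,t'$: $\Gamma(A_{\lambda_i})\subseteq\Gamma(\chi_\Pi)$; $A_{\lambda_i}$ commutes with $A$; and $A_{\lambda_i}A_{\lambda_j}=A_{\lambda_j}A_{\lambda_i}=0$ for every $j\in\{1,\dots,t'\}$ with $j\neq i$.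
   Context: $M_n(\mathbb{C})$ is the algebra of complex $n\times n$ matrices. $J_r(\lambda)$ is the $r\times r$ (upper triangular) Jordan block with eigenvalue $\lambda$, and $\nu_h:=(1,\omega,\dots,\omega^{h-1})$. The numbers $\lambda_1,\dots,\lambda_{t'}$ need not be distinct; the subscript in $A_{\lambda_i}$ refers to the index $i$. The digraph $\Gamma(B)$ of $B=[b_{ij}]\in M_n(\mathbb{C})$ has vertex set $\{1,\dots,n\}$ and arc set $\{(i,j): b_{ij}\neq 0\}$; $\Gamma(B)\subseteq\Gamma(C)$ means that the arc set of $\Gamma(B)$ is contained in that of $\Gamma(C)$. For an ordered partition $\Pi=(\pi_1,\dots,\pi_h)$ of $\{1,\dots,n\}$ into $h$ nonempty subsets, the cyclic characteristic matrix $\chi_\Pi$ is the $n\times n$ matrix whose $(i,j)$-entry is $1$ if there is $\ell\in\{1,\dots,h\}$ with $i\in\pi_\ell$ and $j\in\pi_{\ell+1}$ (where $\pi_{h+1}:=\pi_1$), and $0$ otherwise. $A$ is $h$-cyclic with ordered partition $\Pi$ if $\Gamma(A)\subseteq\Gamma(\chi_\Pi)$. The partition is consecutive if $\pi_1=\{1,\dots,i_1\}$, $\pi_2=\{i_1+1,\dots,i_2\}$, ..., $\pi_h=\{i_{h-1}+1,\dots,n\}$. Choice of $Z$: write $\alpha_{pq}:=(p-q)\bmod h\in\{0,\dots,h-1\}$. For each $i$, the $r_ih$ columns of $Z$ corresponding to the block $J(\lambda_i\nu_h,r_i)$ are, in order, $x_{\langle 0,1\rangle},\dots,x_{\langle 0,r_i\rangle},x_{\langle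 1,1\rangle},\dots,x_{\langle 1,r_i\rangle},\dots,x_{\langle h-1,1\rangle},\dots,x_{\langle h-1,r_i\rangle}$ (these vectors depend on $i$). Here $\{x_{\langle 0,j\rangle}\}_{j=1}^{r_i}$ is a right Jordan chain of $A$ for $\lambda_i$, i.e. $x_{\langle 0,1\rangle}\ne 0$, $Ax_{\langle 0,1\rangle}=\lambda_i x_{\langle 0,1\rangle}$ and $Ax_{\langle 0,j\rangle}=x_{\langle 0,j-1\rangle}+\lambda_i x_{\langle 0,j\rangle}$ for $j\geq 2$. If $x_{\langle 0,j\rangle}$ has blocks $x_{1j},\dots,x_{hj}$, where the $p$-th block consists of the entries indexed by $\pi_p$, then $x_{\langle k,j\rangle}$ is the vector whose $p$-th block is $(\omega^k)^{\alpha_{pj}}x_{pj}$, for $p=1,\dots,h$ and $k=0,\dots,h-1$; the chain $\{x_{\langle k,j\rangle}\}_{j=1}^{r_i}$ is a right Jordan chain of $A$ for $\lambda_i\omega^k$. A Jordan form and a matrix $Z$ of this kind exist for every such $A$. *)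

theory Defs
  imports
    Complex_Main
    "HOL-Library.Disjoint_Sets"
    "Jordan_Normal_Form.Jordan_Normal_Form"
    "Graph_Theory.Pair_Digraph"
begin

text \<open>
  All indices start at 0: rows, columns and digraph vertices of an \<open>n \<times> n\<close> matrix range over
  \<open>{0..<n}\<close>, and the blocks of an ordered partition, the summands of the Jordan form and the
  members of a Jordan chain are numbered from 0 as well.
\<close>

definition mat_digraph :: "'a::zero mat \<Rightarrow> nat pair_pre_digraph" where
  "mat_digraph B = \<lparr> pverts = {0..<dim_row B},
     parcs = {(i, j). i < dim_row B \<and> j < dim_col B \<and> B $$ (i, j) \<noteq> 0} \<rparr>"

definition ordered_partition :: "nat \<Rightarrow> nat \<Rightarrow> nat set list \<Rightarrow> bool" where
  "ordered_partition n h \<pi> \<longleftrightarrow>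
     length \<pi> = h \<and> distinct \<pi> \<and> partition_on {0..<n} (set \<pi>)"

definition consecutive_partition :: "nat \<Rightarrow> nat set list \<Rightarrow> bool" where
  "consecutive_partition n \<pi> \<longleftrightarrow>
     (\<exists>c :: nat \<Rightarrow> nat. c 0 = 0 \<and> c (length \<pi>) = n \<and>
        (\<forall>p < length \<pi>. \<pi> ! p = {c p..<c (Suc p)}))"

definition cyc_char_mat :: "nat \<Rightarrow> nat set list \<Rightarrow> complex mat" where
  "cyc_char_mat n \<pi> = mat n n (\<lambda>(i, j).
     if \<exists>l < length \<pi>. i \<in> \<pi> ! l \<and> j \<in> \<pi> ! (Suc l mod length \<pi>) then 1 else 0)"

definition cyclic_with :: "nat \<Rightarrow> nat set list \<Rightarrow> complex mat \<Rightarrow> bool" where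
  "cyclic_with n \<pi> A \<longleftrightarrow>
     A \<in> carrier_mat n n \<and>
     parcs (mat_digraph A) \<subseteq> parcs (mat_digraph (cyc_char_mat n \<pi>))"

definition root_omega :: "nat \<Rightarrow> complex" where
  "root_omega h = exp (2 * of_real pi * \<i> / of_nat h)"

text \<open>\<open>J(a \<nu>\<^sub>h, r)\<close>, the direct sum of the Jordan blocks \<open>J\<^sub>r(a \<omega>\<^sup>k)\<close> for \<open>k < h\<close>.\<close>

definition jordan_nu :: "nat \<Rightarrow> complex \<Rightarrow> nat \<Rightarrow> complex mat" where
  "jordan_nu h a r = jordan_matrix (map (\<lambda>k. (r, a * root_omega h ^ k)) [0..<h])"

definition cyclic_jordan :: "nat \<Rightarrow> nat \<Rightarrow> (nat \<Rightarrow> complex) \<Rightarrow> (nat \<Rightarrow> nat) \<Rightarrow> complex mat" where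
  "cyclic_jordan h t lam r = diag_block_mat (map (\<lambda>i. jordan_nu h (lam i) (r i)) [0..<t])"

definition cyclic_jordan_at ::
    "nat \<Rightarrow> nat \<Rightarrow> (nat \<Rightarrow> complex) \<Rightarrow> (nat \<Rightarrow> nat) \<Rightarrow> nat \<Rightarrow> complex mat" where
  "cyclic_jordan_at h t lam r i = diag_block_mat
     (map (\<lambda>m. if m = i then jordan_nu h (lam m) (r m) else 0\<^sub>m (r m * h) (r m * h)) [0..<t])"

definition right_jordan_chain ::
    "nat \<Rightarrow> complex mat \<Rightarrow> complex \<Rightarrow> nat \<Rightarrow> (nat \<Rightarrow> complex vec) \<Rightarrow> bool" where
  "right_jordan_chain n A a r x \<longleftrightarrow>
     (\<forall>j < r. x j \<in> carrier_vec n) \<and>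
     x 0 \<noteq> 0\<^sub>v n \<and>
     A *\<^sub>v x 0 = a \<cdot>\<^sub>v x 0 \<and>
     (\<forall>j. Suc j < r \<longrightarrow> A *\<^sub>v x (Suc j) = x j + a \<cdot>\<^sub>v x (Suc j))"

text \<open>The exponent depends only on \<open>p - q\<close>, so it is unaffected by numbering both \<open>p\<close> and \<open>q\<close>
  from 0 instead of 1. The subtraction is done in \<^typ>\<open>int\<close> since \<open>q\<close> may exceed \<open>p\<close>.\<close>

definition alpha :: "nat \<Rightarrow> nat \<Rightarrow> nat \<Rightarrow> nat" where
  "alpha h p q = nat ((int p - int q) mod int h)"

definition block_index :: "nat set list \<Rightarrow> nat \<Rightarrow> nat" where
  "block_index \<pi> v = (THE p. p < length \<pi> \<and> v \<in> \<pi> ! p)"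

text \<open>The \<open>j\<close>-th vector of the chain for \<open>a \<omega>\<^sup>k\<close>, built from the \<open>j\<close>-th vector \<open>y\<close> of the chain
  for \<open>a\<close> by multiplying its \<open>p\<close>-th block by a power of \<open>\<omega>\<^sup>k\<close>.\<close>

definition rotated_vec ::
    "nat \<Rightarrow> nat \<Rightarrow> nat set list \<Rightarrow> nat \<Rightarrow> nat \<Rightarrow> complex vec \<Rightarrow> complex vec" where
  "rotated_vec n h \<pi> k j y =
     vec n (\<lambda>v. (root_omega h ^ k) ^ alpha h (block_index \<pi> v) j * y $ v)"

text \<open>The columns of \<open>Z\<close> belonging to the \<open>i\<close>-th summand start at column
  \<open>(\<Sum>m<i. r m * h)\<close>; within them, \<open>k\<close> is the outer and \<open>j\<close> the inner index.\<close>

definition compatible_chains ::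
    "nat \<Rightarrow> nat \<Rightarrow> nat set list \<Rightarrow> complex mat \<Rightarrow> nat \<Rightarrow> (nat \<Rightarrow> complex) \<Rightarrow> (nat \<Rightarrow> nat) \<Rightarrow>
     complex mat \<Rightarrow> bool" where
  "compatible_chains n h \<pi> A t lam r Z \<longleftrightarrow>
     (\<forall>i < t. \<exists>x. right_jordan_chain n A (lam i) (r i) x \<and>
        (\<forall>k < h. \<forall>j < r i.
           col Z ((\<Sum>m<i. r m * h) + k * r i + j) = rotated_vec n h \<pi> k j (x j)))"

end

theory Submission
  imports Defs
begin

text \<open>
  Let \<open>D\<close> be the diagonal matrix with entry \<open>\<omega>\<^sup>p\<close> on the \<open>p\<close>-th block of \<open>\<Pi>\<close>. A matrix \<open>B\<close> is
  \<open>h\<close>-cyclic with partition \<open>\<Pi>\<close> iff \<open>B D = \<omega> D B\<close>. By the choice of the chains, \<open>D\<close> maps the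
  \<open>j\<close>-th vector of the chain for \<open>\<lambda>\<^sub>i \<omega>\<^sup>k\<close> to \<open>\<omega>\<^sup>j\<close> times the \<open>j\<close>-th vector of the chain for
  \<open>\<lambda>\<^sub>i \<omega>\<^sup>k\<^sup>+\<^sup>1\<close>, so it preserves the span of the columns of \<open>Z\<close> belonging to each summand and
  commutes with the projection \<open>Q\<close> onto the \<open>i\<close>-th of these spans. Since the \<open>i\<close>-th part of \<open>A\<close> is
  \<open>Q A\<close>, it inherits the relation \<open>B D = \<omega> D B\<close> from \<open>A\<close>.
\<close>

section \<open>Powers of the root of unity and the exponents \<open>alpha\<close>\<close>

lemma root_omega_power: "root_omega h ^ k = cis (2 * pi * real k / real h)"
proof -
  have "root_omega h = cis (2 * pi / real h)"
    by (simp add: root_omega_def cis_conv_exp mult_ac)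
  then show ?thesis by (simp add: DeMoivre mult_ac)
qed

lemma root_omega_power_mod:
  assumes "h > 0"
  shows "root_omega h ^ (k mod h) = root_omega h ^ k"
proof -
  have "root_omega h ^ h = 1"
    using assms by (simp add: root_omega_power)
  then have "root_omega h ^ (h * (k div h)) = 1" by (simp add: power_mult)
  then show ?thesis by (metis mult_div_mod_eq power_add mult_1)
qed

text \<open>The powers with exponents below \<open>h\<close> enumerate the \<open>h\<close>-th roots
  of unity bijectively, so they are distinct; all other exponents reduce modulo
  \<open>h\<close>.\<close>

lemma root_omega_power_eq_iff:
  assumes "h > 0"
  shows "root_omega h ^ k = root_omega h ^ l \<longleftrightarrow> k mod h = l mod h"
proof -
  have "inj_on (\<lambda>k. root_omega h ^ k) {..<h}"
    using bij_betw_roots_unity[OF assms] by (simp add: bij_betw_def root_omega_power)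
  then have "root_omega h ^ (k mod h) = root_omega h ^ (l mod h) \<longleftrightarrow> k mod h = l mod h"
    using assms by (intro inj_on_eq_iff) auto
  then show ?thesis using assms by (simp add: root_omega_power_mod)
qed

text \<open>Moves the integer subtraction in \<open>alpha\<close> to the other side, so that the
  factor of \<open>rotated_vec\<close> can be handled through sums of natural exponents.\<close>

lemma alpha_add_mod:
  assumes "h > 0"
  shows "(alpha h p q + q) mod h = p mod h"
proof -
  have "int ((alpha h p q + q) mod h) = int (p mod h)"
    using assms by (simp add: alpha_def of_nat_mod mod_simps)
  then show ?thesis by simp
qed

section \<open>Block indices and the arcs of the cyclic characteristic matrix\<close>

lemma block_index_eqI:
  assumes "ordered_partition n h \<pi>" "p < h" "v \<in> \<pi> ! p"
  shows "block_index \<pi> v = p"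
proof -
  have len: "length \<pi> = h" and dist: "distinct \<pi>" and disj: "disjoint (set \<pi>)"
    using assms(1) by (auto simp: ordered_partition_def partition_on_def)
  have uniq: "q = p" if "q < h" "v \<in> \<pi> ! q" for q
  proof -
    have "\<pi> ! q = \<pi> ! p"
      using disjointD[OF disj, of "\<pi> ! q" "\<pi> ! p"] that assms(2,3) len by auto
    then show ?thesis using dist len that(1) assms(2) by (simp add: nth_eq_iff_index_eq)
  qed
  then show ?thesis
    unfolding block_index_def using assms(2,3) len uniq by blast
qed

lemma block_index_props:
  assumes "ordered_partition n h \<pi>" "v < n"
  shows "block_index \<pi> v < h" "v \<in> \<pi> ! block_index \<pi> v"
proof -
  have "v \<in> \<Union> (set \<pi>)" and len: "length \<pi> = h"
    using assms by (auto simp: ordered_partition_def partition_on_def)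
  then obtain p where "p < h" "v \<in> \<pi> ! p" by (auto simp: in_set_conv_nth)
  then show "block_index \<pi> v < h" "v \<in> \<pi> ! block_index \<pi> v"
    using block_index_eqI[OF assms(1)] by auto
qed

text \<open>Each vertex lies in exactly one block, so the only possible witness \<open>l\<close> is
  the block of \<open>u\<close>, and the existential becomes an equation of indices.\<close>

lemma parcs_cyc_char_mat_iff:
  assumes "ordered_partition n h \<pi>"
  shows "(u, v) \<in> parcs (mat_digraph (cyc_char_mat n \<pi>)) \<longleftrightarrow>
    u < n \<and> v < n \<and> block_index \<pi> v = Suc (block_index \<pi> u) mod h"
proof -
  have len: "length \<pi> = h" using assms by (simp add: ordered_partition_def)
  have "(\<exists>l < h. u \<in> \<pi> ! l \<and> v \<in> \<pi> ! (Suc l mod h)) \<longleftrightarrow>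
      block_index \<pi> v = Suc (block_index \<pi> u) mod h" if "u < n" "v < n"
  proof
    assume "\<exists>l < h. u \<in> \<pi> ! l \<and> v \<in> \<pi> ! (Suc l mod h)"
    then obtain l where l: "l < h" "u \<in> \<pi> ! l" "v \<in> \<pi> ! (Suc l mod h)" by blast
    then have "Suc l mod h < h" by simp
    with l show "block_index \<pi> v = Suc (block_index \<pi> u) mod h"
      using block_index_eqI[OF assms] by metis
  next
    assume "block_index \<pi> v = Suc (block_index \<pi> u) mod h"
    then show "\<exists>l < h. u \<in> \<pi> ! l \<and> v \<in> \<pi> ! (Suc l mod h)"
      using block_index_props[OF assms] that by metis
  qed
  then show ?thesis by (auto simp: mat_digraph_def cyc_char_mat_def len)
qed

section \<open>The phase matrix D and the commutation relation expressing cyclicity\<close>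

definition block_phase :: "nat \<Rightarrow> nat \<Rightarrow> nat set list \<Rightarrow> complex mat" where
  "block_phase n h \<pi> = mat_diag n (\<lambda>v. root_omega h ^ block_index \<pi> v)"

lemma block_phase_carrier [simp]: "block_phase n h \<pi> \<in> carrier_mat n n"
  by (simp add: block_phase_def)

text \<open>Entry (u, v) of the matrix equation says that \<open>B $$ (u, v)\<close> times the power
  with exponent p(v) equals the same entry times the power with exponent p(u) + 1. Cancelling a
  nonzero entry leaves exactly the arc condition.\<close>

lemma cyclic_iff_block_phase:
  assumes "ordered_partition n h \<pi>" "h > 0" "B \<in> carrier_mat n n"
  shows "parcs (mat_digraph B) \<subseteq> parcs (mat_digraph (cyc_char_mat n \<pi>)) \<longleftrightarrow>
    B * block_phase n h \<pi> = root_omega h \<cdot>\<^sub>m (block_phase n h \<pi> * B)"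
proof -
  let ?p = "block_index \<pi>" and ?w = "root_omega h"
  have phase: "?w ^ ?p v = ?w ^ Suc (?p u) \<longleftrightarrow> ?p v = Suc (?p u) mod h" if "v < n" for u v
    using block_index_props(1)[OF assms(1) that] assms(2)
    by (simp add: root_omega_power_eq_iff del: power_Suc)
  have "parcs (mat_digraph B) \<subseteq> parcs (mat_digraph (cyc_char_mat n \<pi>)) \<longleftrightarrow>
      (\<forall>u<n. \<forall>v<n. B $$ (u, v) \<noteq> 0 \<longrightarrow> ?p v = Suc (?p u) mod h)"
    using assms(3) parcs_cyc_char_mat_iff[OF assms(1)]
    by (auto simp: subset_iff mat_digraph_def)
  also have "\<dots> \<longleftrightarrow> (\<forall>u<n. \<forall>v<n. B $$ (u, v) * ?w ^ ?p v = ?w * (?w ^ ?p u * B $$ (u, v)))"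
    using phase by (auto simp: mult_ac)
  also have "\<dots> \<longleftrightarrow> B * block_phase n h \<pi> = ?w \<cdot>\<^sub>m (block_phase n h \<pi> * B)"
    using assms(3) unfolding block_phase_def
    by (auto simp: mat_eq_iff mat_diag_mult_left[of _ n n] mat_diag_mult_right[of _ n n])
  finally show ?thesis .
qed

text \<open>On block p, D multiplies by the power with exponent p, which splits into exponents
  \<open>alpha h p j\<close> and j. The first part raises k by one inside the rotated vector, the
  second is the scalar outside. The reduction modulo \<open>h\<close> sends the last chain back to
  the first.\<close>

lemma block_phase_rotated_vec:
  assumes "h > 0" "y \<in> carrier_vec n"
  shows "block_phase n h \<pi> *\<^sub>v rotated_vec n h \<pi> k j y =
    root_omega h ^ j \<cdot>\<^sub>v rotated_vec n h \<pi> (Suc k mod h) j y"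
proof (rule eq_vecI)
  fix v assume "v < dim_vec (root_omega h ^ j \<cdot>\<^sub>v rotated_vec n h \<pi> (Suc k mod h) j y)"
  then have v: "v < n" by (simp add: rotated_vec_def)
  define p where "p = block_index \<pi> v"
  let ?w = "root_omega h" and ?a = "alpha h p j"
  have "?w ^ p = ?w ^ (?a + j)"
    using assms(1) by (simp add: root_omega_power_eq_iff alpha_add_mod del: power_add)
  then have "?w ^ p * (?w ^ k) ^ ?a = ?w ^ j * (?w ^ (Suc k mod h)) ^ ?a"
    using assms(1) by (simp add: root_omega_power_mod power_add power_mult_distrib mult_ac)
  moreover have "(block_phase n h \<pi> *\<^sub>v rotated_vec n h \<pi> k j y) $ v =
      ?w ^ p * rotated_vec n h \<pi> k j y $ v"
    using v unfolding block_phase_def mat_diag_def p_def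
    by (simp add: scalar_prod_def rotated_vec_def if_distrib[of "\<lambda>c. c * _"] cong: if_cong)
  ultimately show "(block_phase n h \<pi> *\<^sub>v rotated_vec n h \<pi> k j y) $ v =
      (?w ^ j \<cdot>\<^sub>v rotated_vec n h \<pi> (Suc k mod h) j y) $ v"
    using v by (simp add: rotated_vec_def flip: p_def mult.assoc)
qed (simp add: rotated_vec_def block_phase_def mat_diag_def)

section \<open>Block-diagonal matrices with square blocks\<close>

lemma diag_block_mat_upt_Suc:
  assumes "\<And>m. m < Suc t \<Longrightarrow> F m \<in> carrier_mat (d m) (d m)"
  shows "diag_block_mat (map F [0..<Suc t]) =
    four_block_mat (diag_block_mat (map F [0..<t])) (0\<^sub>m (\<Sum>m<t. d m) (d t))
      (0\<^sub>m (d t) (\<Sum>m<t. d m)) (F t)"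
proof -
  have "(\<Sum>m\<leftarrow>[0..<t]. dim_row (F m)) = (\<Sum>m<t. d m)"
    "(\<Sum>m\<leftarrow>[0..<t]. dim_col (F m)) = (\<Sum>m<t. d m)"
    by (simp_all add: interv_sum_list_conv_sum_set_nat atLeast0LessThan carrier_matD[OF assms])
  then show ?thesis using assms[of t]
    by (simp add: diag_block_mat_last Let_def dim_diag_block_mat o_def)
qed

lemma diag_block_mat_upt_carrier:
  assumes "\<And>m. m < t \<Longrightarrow> F m \<in> carrier_mat (d m) (d m)"
  shows "diag_block_mat (map F [0..<t]) \<in> carrier_mat (\<Sum>m<t. d m) (\<Sum>m<t. d m)"
  using assms
proof (induction t)
  case (Suc t)
  then show ?case by (subst diag_block_mat_upt_Suc[of t F d]) auto
qed auto

text \<open>Induction on \<open>t\<close>, splitting off the last block because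
  \<open>[0..<Suc t]\<close> grows at its end. The zero off-diagonal blocks kill the mixed terms of
  the 2 by 2 block product.\<close>

lemma mult_diag_block_mat:
  fixes F G :: "nat \<Rightarrow> 'a::semiring_0 mat"
  assumes "\<And>m. m < t \<Longrightarrow> F m \<in> carrier_mat (d m) (d m)"
    and "\<And>m. m < t \<Longrightarrow> G m \<in> carrier_mat (d m) (d m)"
  shows "diag_block_mat (map F [0..<t]) * diag_block_mat (map G [0..<t]) =
    diag_block_mat (map (\<lambda>m. F m * G m) [0..<t])"
  using assms
proof (induction t)
  case (Suc t)
  let ?s = "\<Sum>m<t. d m"
  have FG: "F m * G m \<in> carrier_mat (d m) (d m)" if "m < Suc t" for m
    using Suc.prems that by (meson mult_carrier_mat)
  have c: "diag_block_mat (map F [0..<t]) \<in> carrier_mat ?s ?s"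
    "diag_block_mat (map G [0..<t]) \<in> carrier_mat ?s ?s"
    "diag_block_mat (map (\<lambda>m. F m * G m) [0..<t]) \<in> carrier_mat ?s ?s"
    using Suc.prems FG by (auto intro!: diag_block_mat_upt_carrier)
  have IH: "diag_block_mat (map F [0..<t]) * diag_block_mat (map G [0..<t]) =
      diag_block_mat (map (\<lambda>m. F m * G m) [0..<t])"
    using Suc.prems by (intro Suc.IH) auto
  have l: "F t \<in> carrier_mat (d t) (d t)" "G t \<in> carrier_mat (d t) (d t)"
    using Suc.prems by auto
  have z: "0\<^sub>m ?s (d t) \<in> carrier_mat ?s (d t)" "0\<^sub>m (d t) ?s \<in> carrier_mat (d t) ?s" by auto
  have split: "diag_block_mat (map H [0..<Suc t]) =
      four_block_mat (diag_block_mat (map H [0..<t])) (0\<^sub>m ?s (d t)) (0\<^sub>m (d t) ?s) (H t)"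
    if "\<forall>m<Suc t. H m \<in> carrier_mat (d m) (d m)" for H :: "nat \<Rightarrow> 'a mat"
    using that by (intro diag_block_mat_upt_Suc) auto
  have all: "\<forall>m<Suc t. F m \<in> carrier_mat (d m) (d m)" "\<forall>m<Suc t. G m \<in> carrier_mat (d m) (d m)"
    "\<forall>m<Suc t. F m * G m \<in> carrier_mat (d m) (d m)"
    using Suc.prems FG by auto
  show ?case
    unfolding split[OF all(1)] split[OF all(2)] split[OF all(3)]
    unfolding mult_four_block_mat[OF c(1) z l(1) c(2) z l(2)] IH
    using c l FG[of t] by simp
qed auto

lemma diag_block_mat_zero:
  "diag_block_mat (map (\<lambda>m. 0\<^sub>m (d m) (d m)) [0..<t]) = 0\<^sub>m (\<Sum>m<t. d m) (\<Sum>m<t. d m)"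
proof (induction t)
  case (Suc t)
  show ?case
    by (subst diag_block_mat_upt_Suc[of t _ d], simp, unfold Suc.IH) (auto intro!: eq_matI)
qed auto

section \<open>Column ranges of the summands and the projections onto them\<close>

definition in_summand :: "(nat \<Rightarrow> nat) \<Rightarrow> nat \<Rightarrow> nat \<Rightarrow> bool" where
  "in_summand d i c \<longleftrightarrow> (\<Sum>m<i. d m) \<le> c \<and> c < (\<Sum>m<Suc i. d m)"

lemma in_summand_exists:
  assumes "c < (\<Sum>m<t. d m)"
  obtains i where "i < t" "in_summand d i c"
  using assms
proof (induction t arbitrary: thesis)
  case (Suc t)
  show ?case
  proof (cases "c < (\<Sum>m<t. d m)")
    case True
    then obtain i where "i < t" "in_summand d i c" using Suc.IH by blast
    then show ?thesis using Suc.prems(1)[of i] by simp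
  next
    case False
    then show ?thesis using Suc.prems(1)[of t] Suc.prems(2) by (simp add: in_summand_def)
  qed
qed auto

lemma in_summand_unique:
  assumes "in_summand d i c" "in_summand d i' c"
  shows "i = i'"
proof -
  have "(\<Sum>m<Suc a. d m) \<le> (\<Sum>m<b. d m)" if "a < b" for a b
    using that by (intro sum_mono2) auto
  then show ?thesis using assms unfolding in_summand_def
    by (metis linorder_neqE_nat not_less order.trans)
qed

definition summand_proj :: "(nat \<Rightarrow> nat) \<Rightarrow> nat \<Rightarrow> nat \<Rightarrow> 'a::{zero,one} mat" where
  "summand_proj d t i =
    diag_block_mat (map (\<lambda>m. if m = i then 1\<^sub>m (d m) else 0\<^sub>m (d m) (d m)) [0..<t])"

text \<open>The block form of the projection multiplies well with Jordan matrices; this 0/1 diagonal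
  form is the one suited to comparing entries in a commutation argument.\<close>

lemma summand_proj_eq_mat_diag:
  "summand_proj d t i = mat_diag (\<Sum>m<t. d m) (\<lambda>c. if in_summand d i c then 1 else 0)"
proof (induction t)
  case 0
  then show ?case by (auto simp: summand_proj_def mat_diag_def)
next
  case (Suc t)
  let ?s = "\<Sum>m<t. d m"
  \<comment> \<open>A position in the newly added block lies in range \<open>t\<close>, and ranges
    are disjoint.\<close>
  have last: "in_summand d i c \<longleftrightarrow> t = i" if "?s \<le> c" "c < ?s + d t" for c
  proof -
    have "in_summand d t c" using that by (simp add: in_summand_def)
    then show ?thesis using in_summand_unique by blast
  qed
  have step: "summand_proj d (Suc t) i =
      four_block_mat (summand_proj d t i) (0\<^sub>m ?s (d t)) (0\<^sub>m (d t) ?s)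
        (if t = i then 1\<^sub>m (d t) else 0\<^sub>m (d t) (d t))"
    unfolding summand_proj_def by (rule diag_block_mat_upt_Suc) auto
  show ?case
    unfolding step Suc.IH using last
    by (intro eq_matI) (auto simp: mat_diag_def)
qed

section \<open>The Jordan matrix and its single summands\<close>

lemma jordan_nu_carrier: "jordan_nu h a r \<in> carrier_mat (r * h) (r * h)"
proof -
  have "sum_list (map fst (map (\<lambda>k. (r, a * root_omega h ^ k)) [0..<h])) = r * h"
    by (simp add: o_def sum_list_triv)
  then show ?thesis unfolding jordan_nu_def by (metis jordan_matrix_carrier)
qed

lemma cyclic_jordan_carrier:
  "cyclic_jordan h t lam r \<in> carrier_mat (\<Sum>m<t. r m * h) (\<Sum>m<t. r m * h)"
  unfolding cyclic_jordan_def by (intro diag_block_mat_upt_carrier jordan_nu_carrier)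

lemma cyclic_jordan_at_carrier:
  "cyclic_jordan_at h t lam r i \<in> carrier_mat (\<Sum>m<t. r m * h) (\<Sum>m<t. r m * h)"
  unfolding cyclic_jordan_at_def
  by (intro diag_block_mat_upt_carrier) (simp add: jordan_nu_carrier)

text \<open>After conjugation by \<open>Z\<close> this exhibits the \<open>i\<close>-th part of A as
  a projection times A.\<close>

lemma summand_proj_mult_cyclic_jordan:
  "summand_proj (\<lambda>m. r m * h) t i * cyclic_jordan h t lam r = cyclic_jordan_at h t lam r i"
  unfolding summand_proj_def cyclic_jordan_def cyclic_jordan_at_def
  by (subst mult_diag_block_mat[where d = "\<lambda>m. r m * h"])
    (auto simp: jordan_nu_carrier left_mult_one_mat[OF jordan_nu_carrier]
      left_mult_zero_mat[OF jordan_nu_carrier] intro!: arg_cong[where f = diag_block_mat])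

lemma cyclic_jordan_at_commute:
  "cyclic_jordan_at h t lam r i * cyclic_jordan h t lam r =
    cyclic_jordan h t lam r * cyclic_jordan_at h t lam r i"
  unfolding cyclic_jordan_def cyclic_jordan_at_def
  by (subst (1 2) mult_diag_block_mat[where d = "\<lambda>m. r m * h"])
    (auto simp: jordan_nu_carrier left_mult_zero_mat[OF jordan_nu_carrier]
      right_mult_zero_mat[OF jordan_nu_carrier] intro!: arg_cong[where f = diag_block_mat])

lemma cyclic_jordan_at_orthogonal:
  assumes "i \<noteq> j"
  shows "cyclic_jordan_at h t lam r i * cyclic_jordan_at h t lam r j =
    0\<^sub>m (\<Sum>m<t. r m * h) (\<Sum>m<t. r m * h)"
proof -
  have "cyclic_jordan_at h t lam r i * cyclic_jordan_at h t lam r j =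
      diag_block_mat (map (\<lambda>m. 0\<^sub>m (r m * h) (r m * h)) [0..<t])"
    unfolding cyclic_jordan_at_def using assms
    by (subst mult_diag_block_mat[where d = "\<lambda>m. r m * h"])
      (auto simp: jordan_nu_carrier left_mult_zero_mat[OF jordan_nu_carrier]
        right_mult_zero_mat[OF jordan_nu_carrier] intro!: arg_cong[where f = diag_block_mat])
  then show ?thesis by (simp add: diag_block_mat_zero)
qed

section \<open>Action of the phase matrix on the columns of \<open>Z\<close>\<close>

lemma summand_position:
  assumes "in_summand (\<lambda>m. r m * h) i c"
  obtains k j where "k < h" "j < r i" "c = (\<Sum>m<i. r m * h) + k * r i + j"
proof -
  define q where "q = c - (\<Sum>m<i. r m * h)"
  have q: "q < h * r i" "c = (\<Sum>m<i. r m * h) + q"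
    using assms by (auto simp: q_def in_summand_def mult.commute)
  \<comment> \<open>A summand of size 0 has an empty column range. Division of the offset by
    \<open>r i\<close> then gives k as quotient and j as remainder.\<close>
  then have "r i > 0" by (cases "r i") auto
  then have "q div r i < h" "q mod r i < r i" "q = q div r i * r i + q mod r i"
    using q(1) by (auto simp: less_mult_imp_div_less)
  then show ?thesis using that q(2) by (metis add.assoc)
qed

lemma in_summandI:
  assumes "k < h" "j < r i"
  shows "in_summand (\<lambda>m. r m * h) i ((\<Sum>m<i. r m * h) + k * r i + j)"
proof -
  have "k * r i + j < Suc k * r i" using assms(2) by simp
  also have "\<dots> \<le> h * r i" using assms(1) by (intro mult_right_mono) auto
  finally show ?thesis by (simp add: in_summand_def mult.commute)
qed

text \<open>D sends the column at (k, j) to a multiple of the one at (k + 1 mod \<open>h\<close>,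
  j). Only the fact that it stays in the same summand is kept.\<close>

lemma block_phase_col:
  assumes "compatible_chains n h \<pi> A t lam r Z" "h > 0"
    and "i < t" "in_summand (\<lambda>m. r m * h) i c"
  obtains c' a where "in_summand (\<lambda>m. r m * h) i c'"
    "block_phase n h \<pi> *\<^sub>v col Z c = a \<cdot>\<^sub>v col Z c'"
proof -
  obtain x where x: "right_jordan_chain n A (lam i) (r i) x"
    and col: "\<And>k j. k < h \<Longrightarrow> j < r i \<Longrightarrow>
      col Z ((\<Sum>m<i. r m * h) + k * r i + j) = rotated_vec n h \<pi> k j (x j)"
    using assms(1,3) unfolding compatible_chains_def by blast
  obtain k j where kj: "k < h" "j < r i" "c = (\<Sum>m<i. r m * h) + k * r i + j"
    using summand_position[OF assms(4)] by blast
  have k': "Suc k mod h < h" using assms(2) by simp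
  have "x j \<in> carrier_vec n" using x kj(2) by (simp add: right_jordan_chain_def)
  from block_phase_rotated_vec[OF assms(2) this, of \<pi> k j]
  show ?thesis using that in_summandI[of _ h j r i, OF k' kj(2)] col kj k' by metis
qed

text \<open>\<open>P\<close> below is D in the basis of columns of \<open>Z\<close>. By
  \<open>block_phase_col\<close> it is block diagonal along the summands, hence commutes with the
  0/1 diagonal matrix \<open>E\<close>; conjugating back gives the claim.\<close>

lemma block_phase_commutes_with_projection:
  assumes chains: "compatible_chains n h \<pi> A t lam r Z" and h: "h > 0"
    and Z: "Z \<in> carrier_mat n n" and Zinv: "Zinv \<in> carrier_mat n n"
    and inv: "Z * Zinv = 1\<^sub>m n" "Zinv * Z = 1\<^sub>m n"
    and n: "n = (\<Sum>m<t. r m * h)"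
  shows "block_phase n h \<pi> * (Z * summand_proj (\<lambda>m. r m * h) t i * Zinv) =
    Z * summand_proj (\<lambda>m. r m * h) t i * Zinv * block_phase n h \<pi>"
proof -
  define D where "D = block_phase n h \<pi>"
  define E :: "complex mat" where "E = summand_proj (\<lambda>m. r m * h) t i"
  define P where "P = Zinv * D * Z"
  let ?in = "in_summand (\<lambda>m. r m * h)"
  have D: "D \<in> carrier_mat n n" by (simp add: D_def)
  have E_diag: "E = mat_diag n (\<lambda>c. if ?in i c then 1 else 0)"
    by (simp add: E_def summand_proj_eq_mat_diag n)
  have E: "E \<in> carrier_mat n n" by (simp add: E_diag)
  have P: "P \<in> carrier_mat n n" using D Z Zinv by (simp add: P_def)
  have supp: "?in i u \<longleftrightarrow> ?in i c" if uc: "u < n" "c < n" "P $$ (u, c) \<noteq> 0" for u c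
  proof -
    obtain l where l: "l < t" "?in l c" using in_summand_exists uc(2) n by metis
    then obtain c' a where c': "?in l c'" "D *\<^sub>v col Z c = a \<cdot>\<^sub>v col Z c'"
      using block_phase_col[OF chains h] unfolding D_def by metis
    \<comment> \<open>The range of summand \<open>l\<close> ends within \<open>n\<close>, so
      \<open>c'\<close> is a genuine column of \<open>Z\<close>.\<close>
    have "(\<Sum>m<Suc l. r m * h) \<le> n" unfolding n using l(1) by (intro sum_mono2) auto
    then have c'n: "c' < n" using c'(1) by (simp add: in_summand_def)
    \<comment> \<open>Column \<open>c\<close> of \<open>P\<close> turns out to be \<open>a\<close>
      times the unit vector at \<open>c'\<close>, so its only possible nonzero entry is in row
      \<open>c'\<close>.\<close>
    have "col P c = Zinv * D *\<^sub>v col Z c"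
      unfolding P_def using D Z Zinv uc(2) by (intro col_mult2[of _ n n _ n]) auto
    also have "\<dots> = Zinv *\<^sub>v (D *\<^sub>v col Z c)"
      using D Z Zinv uc(2) by (intro assoc_mult_mat_vec[of _ n n _ n]) auto
    also have "\<dots> = a \<cdot>\<^sub>v (Zinv *\<^sub>v col Z c')"
      using Z Zinv c'n unfolding c'(2) by (intro mult_mat_vec) auto
    also have "Zinv *\<^sub>v col Z c' = col (1\<^sub>m n) c'"
      using col_mult2[OF Zinv Z c'n] by (simp only: inv(2))
    finally have "P $$ (u, c) = (a \<cdot>\<^sub>v col (1\<^sub>m n) c') $ u"
      using P uc by (metis carrier_matD index_col)
    with uc c'n have "u = c'" by (auto split: if_splits)
    then show ?thesis using l(2) c'(1) in_summand_unique by metis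
  qed
  \<comment> \<open>The two products scale entry (u, c) of \<open>P\<close> by the indicators of
    \<open>c\<close> and of \<open>u\<close>; these agree wherever \<open>P\<close> is
    nonzero.\<close>
  have PE: "P * E = E * P"
    using P supp unfolding E_diag mat_diag_mult_left[OF P] mat_diag_mult_right[OF P]
    by (intro eq_matI) auto
  have DZ: "D * Z = Z * P"
  proof -
    have "Z * P = (Z * Zinv) * (D * Z)"
      using D Z Zinv by (simp add: P_def assoc_mult_mat[of _ n n _ n _ n])
    then show ?thesis using D Z by (simp add: inv)
  qed
  have ZD: "Zinv * D = P * Zinv"
  proof -
    have "P * Zinv = Zinv * D * (Z * Zinv)"
      using D Z Zinv by (simp add: P_def assoc_mult_mat[of _ n n _ n _ n])
    then show ?thesis using D Zinv by (simp add: inv)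
  qed
  have "D * (Z * E * Zinv) = (D * Z) * E * Zinv"
    using D Z Zinv E by (simp add: assoc_mult_mat[of _ n n _ n _ n])
  also have "\<dots> = Z * (P * E) * Zinv"
    using Z Zinv E P by (simp add: DZ assoc_mult_mat[of _ n n _ n _ n])
  also have "\<dots> = Z * E * (Zinv * D)"
    using Z Zinv E P by (simp add: PE ZD assoc_mult_mat[of _ n n _ n _ n])
  also have "\<dots> = Z * E * Zinv * D"
    using D Z Zinv E by (simp add: assoc_mult_mat[of _ n n _ n _ n])
  finally show ?thesis by (simp only: D_def E_def)
qed

section \<open>Transfer from the Jordan form to A\<close>

lemma similar_mult:
  fixes Z :: "'a::semiring_1 mat"
  assumes "Z \<in> carrier_mat n n" "Zinv \<in> carrier_mat n n" "Zinv * Z = 1\<^sub>m n"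
    and "X \<in> carrier_mat n n" "Y \<in> carrier_mat n n"
  shows "(Z * X * Zinv) * (Z * Y * Zinv) = Z * (X * Y) * Zinv"
proof -
  have "(Z * X * Zinv) * (Z * Y * Zinv) = Z * X * (Zinv * Z) * Y * Zinv"
    using assms(1,2,4,5) by (simp add: assoc_mult_mat[of _ n n _ n _ n])
  then show ?thesis using assms by (simp add: assoc_mult_mat[of _ n n _ n _ n])
qed

theorem theorem4p6:
  fixes n h t :: nat
    and \<pi> :: "nat set list"
    and A Z Zinv :: "complex mat"
    and lam :: "nat \<Rightarrow> complex"
    and r :: "nat \<Rightarrow> nat"
    and A_part :: "nat \<Rightarrow> complex mat"
  assumes "h \<ge> 2"
    and "A \<in> carrier_mat n n"
    and "invertible_mat A"
    and "ordered_partition n h \<pi>"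
    and "consecutive_partition n \<pi>"
    and "cyclic_with n \<pi> A"
    and "\<forall>i < t. r i > 0"
    and "Z \<in> carrier_mat n n"
    and "Zinv \<in> carrier_mat n n"
    and "Z * Zinv = 1\<^sub>m n"
    and "Zinv * Z = 1\<^sub>m n"
    and "Zinv * A * Z = cyclic_jordan h t lam r"
    and "compatible_chains n h \<pi> A t lam r Z"
    and "\<forall>i < t. A_part i = Z * cyclic_jordan_at h t lam r i * Zinv"
  shows "\<forall>i < t.
      parcs (mat_digraph (A_part i)) \<subseteq> parcs (mat_digraph (cyc_char_mat n \<pi>)) \<and>
      A_part i * A = A * A_part i \<and>
      (\<forall>j < t. j \<noteq> i \<longrightarrow>
         A_part i * A_part j = 0\<^sub>m n n \<and> A_part j * A_part i = 0\<^sub>m n n)"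
proof (intro allI impI conjI)
  define J where "J = cyclic_jordan h t lam r"
  note A = \<open>A \<in> carrier_mat n n\<close> and Z = \<open>Z \<in> carrier_mat n n\<close>
    and Zinv = \<open>Zinv \<in> carrier_mat n n\<close> and inv = \<open>Z * Zinv = 1\<^sub>m n\<close> \<open>Zinv * Z = 1\<^sub>m n\<close>
  have h: "h > 0" using \<open>h \<ge> 2\<close> by simp
  have part: "A_part i = Z * cyclic_jordan_at h t lam r i * Zinv" if "i < t" for i
    using that assms(14) by blast
  have J: "J = Zinv * A * Z" using assms(12) by (simp add: J_def)
  \<comment> \<open>Comparing the row counts of the two sides of
    \<open>J = Zinv * A * Z\<close>.\<close>
  have n: "n = (\<Sum>m<t. r m * h)"
    using carrier_matD(1)[OF cyclic_jordan_carrier[of h t lam r]] Zinv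
    by (simp flip: J_def add: J)
  have Jc: "J \<in> carrier_mat n n"
    using cyclic_jordan_carrier[of h t lam r] by (simp add: J_def n)
  have Jat: "cyclic_jordan_at h t lam r i \<in> carrier_mat n n" for i
    using cyclic_jordan_at_carrier[of h t lam r i] by (simp add: n)
  \<comment> \<open>With A and its parts all written as conjugates by \<open>Z\<close>, commutation
    and orthogonality reduce to identities between block-diagonal matrices.\<close>
  have A_eq: "A = Z * J * Zinv"
  proof -
    have "Z * J * Zinv = (Z * Zinv) * A * (Z * Zinv)"
      using A Z Zinv by (simp add: J assoc_mult_mat[of _ n n _ n _ n])
    then show ?thesis using A by (simp add: inv)
  qed
  note sim = similar_mult[OF Z Zinv inv(2)]
  fix i assume i: "i < t"
  show "A_part i * A = A * A_part i"
    unfolding part[OF i] A_eq sim[OF Jat Jc] sim[OF Jc Jat]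
    by (simp add: J_def cyclic_jordan_at_commute)
  have zero: "A_part k * A_part l = 0\<^sub>m n n" if "k < t" "l < t" "k \<noteq> l" for k l
    unfolding part[OF that(1)] part[OF that(2)] sim[OF Jat Jat]
      cyclic_jordan_at_orthogonal[OF that(3)] n[symmetric]
    using Z Zinv by simp
  show "A_part i * A_part j = 0\<^sub>m n n" "A_part j * A_part i = 0\<^sub>m n n" if "j < t" "j \<noteq> i" for j
    using zero i that by auto
  define E :: "complex mat" where "E = summand_proj (\<lambda>m. r m * h) t i"
  define Q where "Q = Z * E * Zinv"
  define D where "D = block_phase n h \<pi>"
  have E: "E \<in> carrier_mat n n" by (simp add: E_def summand_proj_eq_mat_diag n)
  have Q: "Q \<in> carrier_mat n n" using Z E Zinv by (simp add: Q_def)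
  have D: "D \<in> carrier_mat n n" by (simp add: D_def)
  have DQ: "D * Q = Q * D"
    unfolding D_def Q_def E_def
    by (rule block_phase_commutes_with_projection[OF assms(13) h Z Zinv inv n])
  have AD: "A * D = root_omega h \<cdot>\<^sub>m (D * A)"
    using assms(6) cyclic_iff_block_phase[OF assms(4) h A] by (simp add: cyclic_with_def D_def)
  have QA: "A_part i = Q * A"
    unfolding part[OF i] Q_def A_eq sim[OF E Jc]
    by (simp add: E_def J_def summand_proj_mult_cyclic_jordan)
  \<comment> \<open>The scalar arises when D passes A, by cyclicity of A; D then passes
    \<open>Q\<close> freely by \<open>DQ\<close>.\<close>
  have "A_part i * D = Q * (A * D)"
    using Q A D by (simp add: QA assoc_mult_mat[of _ n n _ n _ n])
  also have "\<dots> = root_omega h \<cdot>\<^sub>m (Q * D * A)"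
    using Q A D by (simp add: AD mult_smult_distrib[of _ n n _ n] assoc_mult_mat[of _ n n _ n _ n])
  also have "\<dots> = root_omega h \<cdot>\<^sub>m (D * A_part i)"
    using Q A D by (simp add: QA assoc_mult_mat[of _ n n _ n _ n] flip: DQ)
  finally show "parcs (mat_digraph (A_part i)) \<subseteq> parcs (mat_digraph (cyc_char_mat n \<pi>))"
    using cyclic_iff_block_phase[OF assms(4) h, of "A_part i"] Q A by (simp add: QA D_def)
qed

end
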